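(* Let $f:\mathbb{R}^n\to\mathbb{R}\cup\{\infty\}$ be a proper, lower semicontinuous, convex function with $\mathrm{dom}\,f$ unbounded. Then $$f^\circ(\infty;d)\le f^\infty(d)\qquad\text{for every }d\in\mathbb{R}^n.$$
   Context: $\mathrm{dom}\,f=\{x\mid f(x)<\infty\}$; $f$ is proper if $\mathrm{dom}\,f\ne\emptyset$. The Clarke directional derivative at infinity is $f^\circ(\infty;d):=\limsup\frac{f(x+td)-f(x)}{t}\in[-\infty,+\infty]$, the limsup taken over $x\in\mathrm{dom}\,f$, $\|x\|\to\infty$, $t\searrow0$ ($t>0$). The recession function is $f^\infty(d)=\lim_{t\to\infty}\frac{f(x_0+td)-f(x_0)}{t}\in\mathbb{R}\cup\{\infty\}$, for any $x_0\in\mathrm{dom}\,f$ (the limit exists and is independent of $x_0$). *)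

theory Defs
  imports "HOL-Analysis.Analysis"
begin

text \<open>
  Functions with values in \<open>\<real> \<union> {\<infinity>}\<close> are modelled as \<open>ereal\<close>-valued functions together with
  the hypothesis \<open>\<forall>x. f x \<noteq> -\<infinity>\<close>, so the sums and differences below never meet \<open>\<infinity> - \<infinity>\<close>.
\<close>

definition edom :: "('a \<Rightarrow> ereal) \<Rightarrow> 'a set" where
  "edom f = {x. f x < \<infinity>}"

definition proper_fun :: "('a \<Rightarrow> ereal) \<Rightarrow> bool" where
  "proper_fun f \<longleftrightarrow> edom f \<noteq> {}"

definition lower_semicontinuous :: "('a::topological_space \<Rightarrow> ereal) \<Rightarrow> bool" where
  "lower_semicontinuous f \<longleftrightarrow> (\<forall>x. f x \<le> Liminf (at x) f)"

text \<open>The library's \<open>convex_on\<close> is restricted to real-valued functions.\<close>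

definition ereal_convex :: "('a::real_vector \<Rightarrow> ereal) \<Rightarrow> bool" where
  "ereal_convex f \<longleftrightarrow> (\<forall>x y. \<forall>u::real. 0 < u \<and> u < 1 \<longrightarrow>
     f ((1 - u) *\<^sub>R x + u *\<^sub>R y) \<le> ereal (1 - u) * f x + ereal u * f y)"

definition diff_quot :: "('a::real_vector \<Rightarrow> ereal) \<Rightarrow> 'a \<Rightarrow> 'a \<Rightarrow> real \<Rightarrow> ereal" where
  "diff_quot f d x t = (f (x + t *\<^sub>R d) - f x) / ereal t"

definition clarke_at_infinity :: "('a::real_normed_vector \<Rightarrow> ereal) \<Rightarrow> 'a \<Rightarrow> ereal" where
  "clarke_at_infinity f d =
     Limsup (inf at_infinity (principal (edom f)) \<times>\<^sub>F at_right 0) (\<lambda>(x, t). diff_quot f d x t)"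

text \<open>
  The common limit of the difference quotients over all base points in the domain; that it
  exists under the standing assumptions is shown in \<open>recession_function_tendsto\<close>.
\<close>

definition recession_function :: "('a::real_vector \<Rightarrow> ereal) \<Rightarrow> 'a \<Rightarrow> ereal" where
  "recession_function f d = (THE l. \<forall>x\<^sub>0\<in>edom f. (diff_quot f d x\<^sub>0 \<longlongrightarrow> l) at_top)"

lemma edom_real:
  assumes "\<forall>x. f x \<noteq> -\<infinity>" "x \<in> edom f"
  obtains a where "f x = ereal a"
  using assms by (cases "f x") (auto simp: edom_def)

lemma diff_quot_mono:
  assumes ni: "\<forall>x. f x \<noteq> -\<infinity>" and cv: "ereal_convex f" and x: "x \<in> edom f"
    and s: "0 < s" "s \<le> t"
  shows "diff_quot f d x s \<le> diff_quot f d x t"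
proof (cases "s = t")
  case False
  then have st: "s < t" using s by simp
  obtain a where a: "f x = ereal a" using edom_real[OF ni x] .
  define u where "u = s / t"
  have u: "0 < u" "u < 1" "u * t = s" using s st by (auto simp: u_def)
  have "(1 - u) *\<^sub>R x + u *\<^sub>R (x + t *\<^sub>R d) = x + s *\<^sub>R d"
    using u(3) by (simp add: algebra_simps)
  then have le: "f (x + s *\<^sub>R d) \<le> ereal (1 - u) * f x + ereal u * f (x + t *\<^sub>R d)"
    using cv u unfolding ereal_convex_def by metis
  show ?thesis
  proof (cases "f (x + t *\<^sub>R d)")
    case (real c)
    with le a have "f (x + s *\<^sub>R d) \<le> ereal ((1 - u) * a + u * c)" by simp
    then obtain b where b: "f (x + s *\<^sub>R d) = ereal b" "b \<le> (1 - u) * a + u * c"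
      using ni by (cases "f (x + s *\<^sub>R d)") auto
    have "b - a \<le> u * (c - a)" using b by (simp add: algebra_simps)
    then have "(b - a) / s \<le> u * (c - a) / s" using s by (simp add: divide_right_mono)
    also have "\<dots> = (c - a) / t" using s st by (simp add: u_def)
    finally show ?thesis using s st by (simp add: diff_quot_def a b real)
  next
    case PInf
    then show ?thesis using a s by (simp add: diff_quot_def)
  next
    case MInf
    then show ?thesis using ni by simp
  qed
qed auto

lemma diff_quot_tendsto_SUP:
  assumes ni: "\<forall>x. f x \<noteq> -\<infinity>" and cv: "ereal_convex f" and x: "x \<in> edom f"
  shows "(diff_quot f d x \<longlongrightarrow> (SUP t\<in>{0<..}. diff_quot f d x t)) at_top"
proof (rule order_tendstoI)
  fix y assume "y < (SUP t\<in>{0<..}. diff_quot f d x t)"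
  then obtain s where s: "s > 0" "y < diff_quot f d x s" by (auto simp: less_SUP_iff)
  show "eventually (\<lambda>t. y < diff_quot f d x t) at_top"
    using eventually_ge_at_top[of s]
    by eventually_elim (use s diff_quot_mono[OF ni cv x s(1)] in \<open>blast intro: less_le_trans\<close>)
next
  fix y assume y: "(SUP t\<in>{0<..}. diff_quot f d x t) < y"
  show "eventually (\<lambda>t. diff_quot f d x t < y) at_top"
    using eventually_gt_at_top[of 0]
    by eventually_elim (use y in \<open>auto intro: le_less_trans[OF SUP_upper]\<close>)
qed

lemma diff_quot_neq_MInf:
  assumes ni: "\<forall>x. f x \<noteq> -\<infinity>" and x: "x \<in> edom f" and t: "0 < t"
  shows "diff_quot f d x t \<noteq> -\<infinity>"
proof -
  obtain a where a: "f x = ereal a" using edom_real[OF ni x] .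
  show ?thesis using ni[rule_format, of "x + t *\<^sub>R d"] t
    by (cases "f (x + t *\<^sub>R d)") (auto simp: diff_quot_def a)
qed

lemma SUP_diff_quot_le:
  fixes f :: "'a::real_normed_vector \<Rightarrow> ereal"
  assumes ni: "\<forall>x. f x \<noteq> -\<infinity>" and cv: "ereal_convex f" and lsc: "lower_semicontinuous f"
    and x0: "x0 \<in> edom f" and x1: "x1 \<in> edom f"
  shows "(SUP t\<in>{0<..}. diff_quot f d x1 t) \<le> (SUP t\<in>{0<..}. diff_quot f d x0 t)"
proof (rule SUP_least)
  fix s :: real assume "s \<in> {0<..}"
  then have s: "s > 0" by simp
  define L0 where "L0 = (SUP t\<in>{0<..}. diff_quot f d x0 t)"
  have up: "diff_quot f d x0 t \<le> L0" if "t > 0" for t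
    unfolding L0_def using that by (auto intro: SUP_upper)
  obtain a where a: "f x0 = ereal a" using edom_real[OF ni x0] .
  obtain b where b: "f x1 = ereal b" using edom_real[OF ni x1] .
  show "diff_quot f d x1 s \<le> L0"
  proof (cases L0)
    case MInf
    then show ?thesis using up[of 1] diff_quot_neq_MInf[OF ni x0, of 1 d] by simp
  next
    case (real L)
    have fx0: "f (x0 + t *\<^sub>R d) \<le> ereal (a + t * L)" if t: "t > 0" for t
    proof -
      obtain c where "f (x0 + t *\<^sub>R d) = ereal c" "(c - a) / t \<le> L"
        using up[OF t] ni[rule_format, of "x0 + t *\<^sub>R d"] t real
        by (cases "f (x0 + t *\<^sub>R d)") (auto simp: diff_quot_def a)
      then show ?thesis using t by (simp add: field_simps)
    qed
    define z where "z = x1 + s *\<^sub>R d"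
    have le: "f (z + u *\<^sub>R (x0 - x1)) \<le> ereal ((1 - u) * b + u * a + s * L)"
      if u: "0 < u" "u < 1" for u
    proof -
      have "(1 - u) *\<^sub>R x1 + u *\<^sub>R (x0 + (s / u) *\<^sub>R d) = z + u *\<^sub>R (x0 - x1)"
        using u by (simp add: z_def algebra_simps)
      then have "f (z + u *\<^sub>R (x0 - x1)) \<le> ereal (1 - u) * f x1 + ereal u * f (x0 + (s / u) *\<^sub>R d)"
        using cv u unfolding ereal_convex_def by metis
      also have "\<dots> \<le> ereal (1 - u) * f x1 + ereal u * ereal (a + (s / u) * L)"
        using u s by (intro add_left_mono ereal_mult_left_mono fx0) auto
      also have "\<dots> = ereal ((1 - u) * b + u * a + s * L)"
        using u by (simp add: b field_simps)
      finally show ?thesis .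
    qed
    have "f z \<le> ereal (b + s * L)"
    proof (rule dense_le)
      fix y assume y: "y < f z"
      have "eventually (\<lambda>w. y < f w) (at z)"
        using lsc y unfolding lower_semicontinuous_def le_Liminf_iff by blast
      then have ev: "eventually (\<lambda>w. y < f w) (nhds z)"
        using y by (auto simp: eventually_nhds_conv_at)
      have "((\<lambda>u. z + u *\<^sub>R (x0 - x1)) \<longlongrightarrow> z + 0 *\<^sub>R (x0 - x1)) (at_right 0)"
        by (intro tendsto_intros)
      then have "eventually (\<lambda>u. y < f (z + u *\<^sub>R (x0 - x1))) (at_right 0)"
        using ev by (auto dest: eventually_compose_filterlim[rotated])
      moreover have "eventually (\<lambda>u::real. 0 < u \<and> u < 1) (at_right 0)"
        using eventually_at_right_real[of 0 1] by simp
      ultimately have "eventually (\<lambda>u. y \<le> ereal ((1 - u) * b + u * a + s * L)) (at_right 0)"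
        by eventually_elim (use le in \<open>blast intro: order.trans less_imp_le\<close>)
      moreover have "((\<lambda>u. ereal ((1 - u) * b + u * a + s * L)) \<longlongrightarrow>
          ereal ((1 - 0) * b + 0 * a + s * L)) (at_right 0)"
        by (intro tendsto_intros)
      ultimately have "y \<le> ereal ((1 - 0) * b + 0 * a + s * L)"
        by (intro tendsto_lowerbound) auto
      then show "y \<le> ereal (b + s * L)" by simp
    qed
    then obtain c where "f z = ereal c" "c \<le> b + s * L"
      using ni by (cases "f z") auto
    then show ?thesis using s by (simp add: diff_quot_def z_def b real field_simps)
  qed simp
qed

lemma recession_function_tendsto:
  fixes f :: "'a::real_normed_vector \<Rightarrow> ereal"
  assumes ni: "\<forall>x. f x \<noteq> -\<infinity>" and cv: "ereal_convex f" and lsc: "lower_semicontinuous f"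
    and x0: "x0 \<in> edom f"
  shows "(diff_quot f d x0 \<longlongrightarrow> recession_function f d) at_top"
    and "recession_function f d = (SUP t\<in>{0<..}. diff_quot f d x0 t)"
    and "recession_function f d \<noteq> -\<infinity>"
proof -
  define L where "L = (SUP t\<in>{0<..}. diff_quot f d x0 t)"
  have lim: "(diff_quot f d x \<longlongrightarrow> L) at_top" if x: "x \<in> edom f" for x
  proof -
    have "(SUP t\<in>{0<..}. diff_quot f d x t) = L"
      unfolding L_def by (intro antisym SUP_diff_quot_le ni cv lsc x x0)
    then show ?thesis using diff_quot_tendsto_SUP[OF ni cv x, of d] by simp
  qed
  have eq: "recession_function f d = L" unfolding recession_function_def
  proof (rule the_equality)
    show "\<forall>x0\<in>edom f. (diff_quot f d x0 \<longlongrightarrow> L) at_top" using lim by blast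
    fix l assume "\<forall>x0\<in>edom f. (diff_quot f d x0 \<longlongrightarrow> l) at_top"
    then show "l = L" using lim[OF x0] x0 by (intro tendsto_unique) auto
  qed
  show "(diff_quot f d x0 \<longlongrightarrow> recession_function f d) at_top" using lim[OF x0] eq by simp
  show "recession_function f d = (SUP t\<in>{0<..}. diff_quot f d x0 t)" using eq L_def by simp
  have "diff_quot f d x0 1 \<le> L" unfolding L_def by (rule SUP_upper) simp
  then show "recession_function f d \<noteq> -\<infinity>"
    using diff_quot_neq_MInf[OF ni x0, of 1 d] eq by auto
qed

end

theory Submission
  imports Defs
begin

text \<open>By convexity, the difference quotient at a fixed base point is nondecreasing in t, so
  its limit as t tends to infinity is its supremum over t > 0. Lower semicontinuity and convexity
  make this supremum the same for all base points of the domain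
  (\<open>recession_function_tendsto\<close>). It thus bounds every quotient with \<open>x\<close>
  in the domain and t > 0, and hence their limsup.\<close>

lemma diff_quot_le_recession_function:
  fixes f :: "'a::real_normed_vector \<Rightarrow> ereal"
  assumes "\<forall>x. f x \<noteq> -\<infinity>" "ereal_convex f" "lower_semicontinuous f"
    and "x \<in> edom f" and "0 < t"
  shows "diff_quot f d x t \<le> recession_function f d"
  unfolding recession_function_tendsto(2)[OF assms(1-4)] using assms(5) by (auto intro: SUP_upper)

theorem proposition4p31:
  fixes f :: "real ^ 'n \<Rightarrow> ereal"
  assumes "\<forall>x. f x \<noteq> -\<infinity>"
    and "proper_fun f"
    and "lower_semicontinuous f"
    and "ereal_convex f"
    and "\<not> bounded (edom f)"
  shows "\<forall>d. clarke_at_infinity f d \<le> recession_function f d"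
proof
  fix d
  \<comment> \<open>The two factors of the product filter supply the two conditions of the uniform
    bound: the principal part keeps \<open>x\<close> in the domain, and \<open>at_right 0\<close>
    keeps \<open>t\<close> positive.\<close>
  have "eventually (\<lambda>x. x \<in> edom f) (inf at_infinity (principal (edom f)))"
    by (simp add: eventually_inf_principal)
  moreover have "eventually (\<lambda>t::real. 0 < t) (at_right 0)"
    by (rule eventually_at_right_less)
  ultimately have "eventually (\<lambda>(x, t::real). x \<in> edom f \<and> 0 < t)
      (inf at_infinity (principal (edom f)) \<times>\<^sub>F at_right 0)"
    unfolding case_prod_beta by (rule eventually_prodI)
  then show "clarke_at_infinity f d \<le> recession_function f d"
    unfolding clarke_at_infinity_def
    by (intro Limsup_bounded, elim eventually_mono)
      (auto intro: diff_quot_le_recession_function[OF assms(1,4,3)])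
qed

end
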